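(* Let $n$ be an odd positive integer. Then $a'(K_{n,n}) \ge n+2 = \Delta+2$, where $\Delta = \Delta(K_{n,n})$.
   Context: All graphs are finite and simple. $K_{n,n}$ denotes the complete bipartite graph with $n$ vertices on each side, and $\Delta(G)$ denotes the maximum degree of a vertex in a graph $G$. A proper edge coloring of a graph $G=(V,E)$ is a map $c:E\to C$ ($C$ a set of colors) with $c(e)\neq c(f)$ for any two distinct adjacent edges $e,f$ (edges sharing an endpoint). A proper edge coloring is acyclic if there is no bichromatic cycle, i.e. no cycle of $G$ whose edges use only two colors; equivalently, the union of any two color classes induces a linear forest (a disjoint union of paths). The acyclic chromatic index $a'(G)$ is the minimum number of colors in an acyclic edge coloring of $G$.
   Formalization: The case n = 1 is excluded (so n is odd and at least 3), because K_{1,1} is a single edge with a'(K_{1,1}) = 1 < 3, so the stated bound fails there. *)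

theory Defs
  imports Main
begin

text \<open>A graph is given by its vertices and its edges, an edge being the two-element set of its
  endpoints; the predicate \<open>simple_graph\<close> carries the well-formedness conditions.\<close>

record 'a graph =
  verts :: "'a set"
  edges :: "'a set set"

definition simple_graph :: "'a graph \<Rightarrow> bool" where
  "simple_graph G \<longleftrightarrow> finite (verts G) \<and> (\<forall>e\<in>edges G. e \<subseteq> verts G \<and> card e = 2)"

definition degree :: "'a graph \<Rightarrow> 'a \<Rightarrow> nat" where
  "degree G v = card {e \<in> edges G. v \<in> e}"

definition max_degree :: "'a graph \<Rightarrow> nat" where
  "max_degree G = Max (degree G ` verts G)"

definition complete_bipartite :: "nat \<Rightarrow> nat \<Rightarrow> (nat + nat) graph" where
  "complete_bipartite m n =
     \<lparr> verts = {..<m} <+> {..<n}, edges = {{Inl i, Inr j} | i j. i < m \<and> j < n} \<rparr>"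

definition proper_edge_coloring :: "'a graph \<Rightarrow> ('a set \<Rightarrow> 'c) \<Rightarrow> bool" where
  "proper_edge_coloring G c \<longleftrightarrow>
     (\<forall>e\<in>edges G. \<forall>f\<in>edges G. e \<noteq> f \<and> e \<inter> f \<noteq> {} \<longrightarrow> c e \<noteq> c f)"

text \<open>A cycle is represented by the list of its vertices in cyclic order, without repeating the
  first vertex at the end.\<close>

definition cycle_edges :: "'a list \<Rightarrow> 'a set set" where
  "cycle_edges vs = {{vs ! i, vs ! (Suc i mod length vs)} | i. i < length vs}"

definition is_cycle :: "'a graph \<Rightarrow> 'a list \<Rightarrow> bool" where
  "is_cycle G vs \<longleftrightarrow> length vs \<ge> 3 \<and> distinct vs \<and> cycle_edges vs \<subseteq> edges G"

definition bichromatic :: "('a set \<Rightarrow> 'c) \<Rightarrow> 'a list \<Rightarrow> bool" where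
  "bichromatic c vs \<longleftrightarrow> (\<exists>a b. c ` cycle_edges vs \<subseteq> {a, b})"

definition acyclic_edge_coloring :: "'a graph \<Rightarrow> ('a set \<Rightarrow> 'c) \<Rightarrow> bool" where
  "acyclic_edge_coloring G c \<longleftrightarrow>
     proper_edge_coloring G c \<and> \<not> (\<exists>vs. is_cycle G vs \<and> bichromatic c vs)"

text \<open>Colors are natural numbers, which is no restriction for finite color sets. The minimum is
  attained for every finite simple graph, as \<open>acyclic_chromatic_index_attained\<close> below shows.\<close>

definition acyclic_chromatic_index :: "'a graph \<Rightarrow> nat" where
  "acyclic_chromatic_index G =
     (LEAST k. \<exists>(C :: nat set) c. finite C \<and> card C = k \<and> c ` edges G \<subseteq> C \<and>
        acyclic_edge_coloring G c)"

lemma simple_graph_complete_bipartite: "simple_graph (complete_bipartite m n)"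
  by (auto simp: simple_graph_def complete_bipartite_def)

lemma finite_edges: "simple_graph G \<Longrightarrow> finite (edges G)"
  by (rule finite_subset[of _ "Pow (verts G)"]) (auto simp: simple_graph_def)

lemma inj_on_acyclic_edge_coloring:
  assumes "inj_on c (edges G)"
  shows "acyclic_edge_coloring G c"
proof -
  have False if cyc: "is_cycle G vs" and bi: "bichromatic c vs" for vs
  proof -
    have len: "length vs \<ge> 3" and d: "distinct vs" and sub: "cycle_edges vs \<subseteq> edges G"
      using cyc by (auto simp: is_cycle_def)
    let ?e = "{vs ! 0, vs ! 1}" and ?f = "{vs ! 1, vs ! 2}"
    let ?g = "{vs ! (length vs - 1), vs ! 0}"
    have mem: "?e \<in> cycle_edges vs" "?f \<in> cycle_edges vs" "?g \<in> cycle_edges vs"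
    proof -
      show "?e \<in> cycle_edges vs"
        unfolding cycle_edges_def using len by (auto intro!: exI[of _ 0])
      show "?f \<in> cycle_edges vs"
        unfolding cycle_edges_def using len
        by (auto intro!: exI[of _ 1] simp: numeral_2_eq_2)
      show "?g \<in> cycle_edges vs"
      proof -
        have "Suc (length vs - 1) mod length vs = 0"
          using len by (subst Suc_diff_1) auto
        then show ?thesis
          unfolding cycle_edges_def using len by (force intro!: exI[of _ "length vs - 1"])
      qed
    qed
    have nth: "vs ! i \<noteq> vs ! j" if "i < j" "j < length vs" for i j
      using that by (simp add: nth_eq_iff_index_eq[OF d])
    have "vs ! 0 \<noteq> vs ! 1" "vs ! 0 \<noteq> vs ! 2" "vs ! 1 \<noteq> vs ! 2"
      "vs ! (length vs - 1) \<noteq> vs ! 0" "vs ! (length vs - 1) \<noteq> vs ! 1"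
      using nth[of 0 1] nth[of 0 2] nth[of 1 2]
        nth[of 0 "length vs - 1"] nth[of 1 "length vs - 1"] len
      by (simp_all add: eq_commute[of "vs ! (length vs - 1)"] eq_commute[of "vs ! (length vs - Suc 0)"])
    then have ne: "?e \<noteq> ?f" "?f \<noteq> ?g" "?e \<noteq> ?g"
      by (auto simp: doubleton_eq_iff)
    have "c ?e \<noteq> c ?f" "c ?f \<noteq> c ?g" "c ?e \<noteq> c ?g"
      using ne mem sub inj_onD[OF assms] by blast+
    then show False
      using bi mem unfolding bichromatic_def by blast
  qed
  moreover have "proper_edge_coloring G c"
    using assms by (auto simp: proper_edge_coloring_def dest: inj_onD)
  ultimately show ?thesis
    by (auto simp: acyclic_edge_coloring_def)
qed

lemma acyclic_chromatic_index_attained: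
  assumes "simple_graph G"
  shows "\<exists>(C :: nat set) c. finite C \<and> card C = acyclic_chromatic_index G \<and> c ` edges G \<subseteq> C \<and>
           acyclic_edge_coloring G c"
proof -
  obtain c :: "'a set \<Rightarrow> nat" where "inj_on c (edges G)"
    using finite_imp_inj_to_nat_seg[OF finite_edges[OF assms]] by blast
  then have "\<exists>(C :: nat set) c. finite C \<and> card C = card (c ` edges G) \<and> c ` edges G \<subseteq> C \<and>
      acyclic_edge_coloring G c"
    using finite_edges[OF assms] inj_on_acyclic_edge_coloring
    by (intro exI[of _ "c ` edges G"] exI[of _ c]) auto
  then have "\<exists>k. \<exists>(C :: nat set) c. finite C \<and> card C = k \<and> c ` edges G \<subseteq> C \<and>
      acyclic_edge_coloring G c"
    by blast
  then show ?thesis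
    unfolding acyclic_chromatic_index_def by (rule LeastI_ex)
qed

end

theory Submission
  imports Defs "HOL-Combinatorics.Cycles"
begin

text \<open>
  Suppose that \<open>n + 1\<close> colors suffice for an odd \<open>n > 1\<close>. Every color class is a matching of at
  most \<open>n\<close> edges, and two perfect matchings always close up to a bichromatic cycle, so at most one
  class is perfect. Since \<open>n * n = n + n * (n - 1)\<close>, the \<open>n * n\<close> edges fit only if one class \<open>a\<close> is
  perfect and each of the other \<open>n\<close> classes has exactly \<open>n - 1\<close> edges
  (\<open>color_classes\<close>).

  The contradiction is one of parity. A color class is a partial injection from left to right
  vertices; a class with \<open>n - 1\<close> edges extends to a permutation in just one way, by sending its
  missing left vertex to its missing right vertex. For two colors with permutations \<open>p\<close> and \<open>q\<close>, the
  components of the union of the two classes are read off from the orbits of \<open>inv q \<circ> p\<close>: an orbit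
  on which both permutations follow genuine edges is a bichromatic cycle, so every orbit contains a
  left vertex missed by one of the two colors (\<open>missing_vertices\<close>). Let \<open>b \<noteq> a\<close> miss the left
  vertex \<open>u\<close> and the right vertex \<open>w\<close>, and let \<open>d\<close> be the color of the edge joining \<open>u\<close> and \<open>w\<close>.

  \<^item> Between \<open>a\<close> and \<open>b\<close>, and between \<open>a\<close> and \<open>d\<close>, only one left vertex is missed. So there is a
    single orbit, of length \<open>n\<close>, and the quotient permutation is even
    (\<open>perfect_against_near_perfect\<close>).
  \<^item> The permutations of \<open>b\<close> and \<open>d\<close> both send \<open>u\<close> to \<open>w\<close>, so \<open>u\<close> is a fixed point of their
    quotient. The other orbits all pass through the left vertex missed by \<open>d\<close>, so there is only one,
    of length \<open>n - 1\<close>, and the quotient is odd (\<open>near_perfect_against_near_perfect\<close>).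

  This is impossible, because the quotient of \<open>a\<close> and \<open>d\<close> is the product of the other two.
\<close>

section \<open>Permutations\<close>

lemma evenperm_cycle_of_list:
  assumes "distinct cs" and "cs \<noteq> []"
  shows "evenperm (cycle_of_list cs) \<longleftrightarrow> odd (length cs)"
  using assms
proof (induction cs rule: cycle_of_list.induct)
  case (1 i j cs)
  have "evenperm (cycle_of_list (i # j # cs)) \<longleftrightarrow>
      (evenperm (transpose i j) \<longleftrightarrow> evenperm (cycle_of_list (j # cs)))"
    unfolding cycle_of_list.simps
    by (intro evenperm_comp permutation_swap_id permutation_of_cycle)
  then show ?case
    using 1 by (simp add: evenperm_swap del: cycle_of_list.simps)
qed (auto simp: evenperm_id)

text \<open>If all orbits meet in \<open>u\<close>, they coincide, so \<open>p\<close> is one cycle through all of \<open>S\<close> and thus a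
  product of \<open>card S - 1\<close> transpositions.\<close>

lemma evenperm_single_orbit:
  assumes perm: "p permutes S" and fin: "finite S" and u: "u \<in> S"
    and reach: "\<And>x. x \<in> S \<Longrightarrow> \<exists>k. (p ^^ k) x = u"
  shows "evenperm p \<longleftrightarrow> odd (card S)"
proof -
  have p: "permutation p"
    using perm fin permutation_permutes by blast
  let ?cs = "support p u"
  have set: "set ?cs = S"
  proof
    show "set ?cs \<subseteq> S"
      unfolding support_set[OF p] using permutes_in_image[OF permutes_funpow[OF perm]] u by auto
    show "S \<subseteq> set ?cs"
    proof
      fix x assume "x \<in> S"
      then have "u \<in> set (support p x)"
        unfolding support_set[OF p] using reach by (metis rangeI)
      moreover have "u \<in> set (support p u)"
        unfolding support_set[OF p] by (rule range_eqI[of _ _ 0]) simp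
      ultimately have "x \<in> set (support p u)"
        using disjoint_support'[OF p, of x u] by blast
      then show "x \<in> set ?cs" .
    qed
  qed
  have "p = cycle_of_list ?cs"
  proof
    fix x
    show "p x = cycle_of_list ?cs x"
      using cycle_restrict[OF p, of x u] id_outside_supp[of x ?cs] permutes_not_in[OF perm, of x]
      unfolding set by (cases "x \<in> S") auto
  qed
  moreover have "distinct ?cs"
    by (rule cycle_of_permutation[OF p])
  moreover from this have "length ?cs = card S"
    using set distinct_card by metis
  moreover have "?cs \<noteq> []"
    using set u by auto
  ultimately show ?thesis
    using evenperm_cycle_of_list by metis
qed

text \<open>The complements of \<open>D\<close> and of its image have the same size, so that any bijection between them
  completes \<open>g\<close>.\<close>

lemma permutation_extending_injection:
  assumes fin: "finite S" and D: "D \<subseteq> S" and inj: "inj_on g D" and im: "g ` D \<subseteq> S"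
  shows "\<exists>p. p permutes S \<and> (\<forall>x\<in>D. p x = g x)"
proof -
  have "card (S - D) = card (S - g ` D)"
    using fin D im card_image[OF inj] by (simp add: card_Diff_subset finite_subset)
  then obtain h where h: "bij_betw h (S - D) (S - g ` D)"
    using finite_same_card_bij fin by blast
  define p where "p x = (if x \<in> D then g x else if x \<in> S then h x else x)" for x
  have "bij_betw p D (g ` D)"
    using inj by (subst bij_betw_cong[of _ _ g]) (auto simp: p_def bij_betw_def)
  moreover have "bij_betw p (S - D) (S - g ` D)"
    using h by (subst bij_betw_cong[of _ _ h]) (auto simp: p_def)
  ultimately have "bij_betw p (D \<union> (S - D)) (g ` D \<union> (S - g ` D))"
    by (rule bij_betw_combine) auto
  then have "bij_betw p S S"
    using D im by (simp add: Un_absorb1)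
  then have "p permutes S"
    by (rule bij_imp_permutes) (use D in \<open>auto simp: p_def\<close>)
  then show ?thesis
    by (auto simp: p_def)
qed

section \<open>Bichromatic subgraphs and orbits\<close>

locale acyclic_bipartite_coloring =
  fixes n :: nat and c :: "(nat + nat) set \<Rightarrow> 'c"
  assumes acyclic: "acyclic_edge_coloring (complete_bipartite n n) c"
begin

abbreviation col :: "nat \<Rightarrow> nat \<Rightarrow> 'c" where
  "col i j \<equiv> c {Inl i, Inr j}"

text \<open>The left vertices that a color reaches. As a color class is a matching, their number is also
  its number of edges.\<close>

definition rows :: "'c \<Rightarrow> nat set" where
  "rows a = {i. i < n \<and> (\<exists>j<n. col i j = a)}"

lemma proper: "proper_edge_coloring (complete_bipartite n n) c"
  using acyclic by (simp add: acyclic_edge_coloring_def)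

lemma edge: "i < n \<Longrightarrow> j < n \<Longrightarrow> {Inl i, Inr j} \<in> edges (complete_bipartite n n)"
  by (auto simp: complete_bipartite_def)

lemma same_column:
  assumes "i < n" "j < n" "j' < n" "col i j = col i j'"
  shows "j = j'"
proof (rule ccontr)
  assume "j \<noteq> j'"
  then have "({Inl i, Inr j} :: (nat + nat) set) \<noteq> {Inl i, Inr j'}"
    by (auto simp: doubleton_eq_iff)
  then show False
    using proper[unfolded proper_edge_coloring_def, rule_format, OF edge[of i j] edge[of i j']] assms
    by simp
qed

lemma same_row:
  assumes "i < n" "i' < n" "j < n" "col i j = col i' j"
  shows "i = i'"
proof (rule ccontr)
  assume "i \<noteq> i'"
  then have "({Inl i, Inr j} :: (nat + nat) set) \<noteq> {Inl i', Inr j}"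
    by (auto simp: doubleton_eq_iff)
  then show False
    using proper[unfolded proper_edge_coloring_def, rule_format, OF edge[of i j] edge[of i' j]] assms
    by simp
qed

text \<open>Going from a left vertex \<open>z\<close> along \<open>p\<close> to the right and back along \<open>q\<close> leads to
  \<open>(inv q \<circ> p) z\<close>. If \<open>p\<close> always followed edges of color \<open>a\<close> and \<open>q\<close> edges of color \<open>b\<close>, the orbit
  of \<open>x\<close> would be traversed as a closed bichromatic walk. Its vertices are distinct within
  one period, and the period is at least 2 because an edge has only one color. This is where
  acyclicity enters.\<close>

lemma orbit_leaves_two_colors:
  assumes p: "p permutes {..<n}" and q: "q permutes {..<n}" and ab: "a \<noteq> b" and x: "x < n"
  shows "\<exists>k. let z = ((inv q \<circ> p) ^^ k) x in col z (p z) \<noteq> a \<or> col z (q z) \<noteq> b"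
proof (rule ccontr)
  let ?r = "inv q \<circ> p"
  let ?x = "\<lambda>t. (?r ^^ t) x"
  assume "\<nexists>k. let z = ?x k in col z (p z) \<noteq> a \<or> col z (q z) \<noteq> b"
  then have a: "col (?x t) (p (?x t)) = a" and b: "col (?x t) (q (?x t)) = b" for t
    by (auto simp: Let_def)
  have r: "?r permutes {..<n}"
    using p q by (intro permutes_compose permutes_inv)
  then have perm: "permutation ?r"
    using permutation_permutes by blast
  have x_lt: "?x t < n" for t
    using permutes_in_image[OF permutes_funpow[OF r], of t x] x by simp
  have p_lt: "p i < n" if "i < n" for i
    using permutes_in_image[OF p, of i] that by simp
  have step: "q (?x (Suc t)) = p (?x t)" for t
    using permutes_inverses(1)[OF q] by simp
  define m where "m = least_power ?r x"
  have "?r x \<noteq> x"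
  proof
    assume "?r x = x"
    then have "q x = p x"
      using step[of 0] by simp
    then show False
      using a[of 0] b[of 0] ab by simp
  qed
  then have m: "m > 1"
    using least_power_gt_one[OF perm] by (simp add: m_def)
  have period: "?x m = x"
    using least_power_of_permutation(1)[OF perm] by (simp add: m_def)
  have "distinct (map ?x [0..<m])"
    using cycle_of_permutation[OF perm, of x] by (simp add: m_def)
  then have inj: "inj_on ?x {..<m}"
    by (simp add: distinct_map atLeast0LessThan)
  \<comment> \<open>the cycle: the left vertices of the orbit at even positions, their \<open>p\<close>-partners in between\<close>
  define w where "w i = (if even i then Inl (?x (i div 2)) else Inr (p (?x (i div 2))))" for i
  define vs :: "(nat + nat) list" where "vs = map w [0..<2 * m]"
  have len: "length vs = 2 * m"
    by (simp add: vs_def)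
  have nth: "vs ! i = w i" if "i < 2 * m" for i
    using that by (simp add: vs_def)
  have "inj_on w {..<2 * m}"
  proof (rule inj_onI)
    fix i j assume ij: "i \<in> {..<2 * m}" "j \<in> {..<2 * m}" and eq: "w i = w j"
    from eq have par: "even i = even j"
      by (auto simp: w_def split: if_splits)
    moreover have "?x (i div 2) = ?x (j div 2)"
      using eq par injD[OF permutes_inj[OF p]] unfolding w_def by (cases "even i") fastforce+
    then have "i div 2 = j div 2"
      by (rule inj_onD[OF inj]) (use ij in \<open>simp_all add: less_mult_imp_div_less mult.commute\<close>)
    ultimately show "i = j"
      by presburger
  qed
  then have dist: "distinct vs"
    by (simp add: vs_def distinct_map atLeast0LessThan)
  have step_edge: "\<exists>i j. i < n \<and> j < n \<and> {w t, w (Suc t mod (2 * m))} = {Inl i, Inr j} \<and>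
      col i j \<in> {a, b}" if t: "t < 2 * m" for t
  proof (cases "even t")
    case True
    then obtain s where s: "t = 2 * s" by blast
    then have "Suc t < 2 * m"
      using t by presburger
    then have "Suc t mod (2 * m) = Suc t"
      by (rule mod_less)
    then have "{w t, w (Suc t mod (2 * m))} = {Inl (?x s), Inr (p (?x s))}"
      using s by (simp add: w_def)
    then show ?thesis
      using a[of s] x_lt[of s] p_lt by blast
  next
    case False
    then obtain s where s: "t = 2 * s + 1" by (metis oddE)
    have "w (Suc t mod (2 * m)) = Inl (?x (Suc s))"
    proof (cases "Suc s = m")
      case True
      then have "Suc t = 2 * m" using s by simp
      then show ?thesis using True period by (simp add: w_def)
    next
      case False
      then have "Suc s < m" using s t by simp
      then have "Suc t mod (2 * m) = 2 * Suc s" using s by simp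
      then show ?thesis by (simp add: w_def)
    qed
    moreover have "w t = Inr (p (?x s))"
      using s by (simp add: w_def)
    ultimately have "{w t, w (Suc t mod (2 * m))} = {Inl (?x (Suc s)), Inr (p (?x s))}"
      by auto
    moreover have "col (?x (Suc s)) (p (?x s)) = b"
      using b[of "Suc s"] step[of s] by simp
    ultimately show ?thesis
      using x_lt[of "Suc s"] p_lt[OF x_lt[of s]] by blast
  qed
  have edges: "\<exists>i j. i < n \<and> j < n \<and> e = {Inl i, Inr j} \<and> col i j \<in> {a, b}"
    if e: "e \<in> cycle_edges vs" for e
  proof -
    from e obtain t where t: "t < 2 * m" and e': "e = {vs ! t, vs ! (Suc t mod (2 * m))}"
      unfolding cycle_edges_def len by blast
    have "Suc t mod (2 * m) < 2 * m"
      using m by simp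
    then have "e = {w t, w (Suc t mod (2 * m))}"
      using nth t e' by metis
    then show ?thesis
      using step_edge[OF t] by simp
  qed
  then have "cycle_edges vs \<subseteq> edges (complete_bipartite n n)" and "c ` cycle_edges vs \<subseteq> {a, b}"
    using edge by fastforce+
  then have "is_cycle (complete_bipartite n n) vs" and "bichromatic c vs"
    using dist len m unfolding is_cycle_def bichromatic_def by auto
  then show False
    using acyclic unfolding acyclic_edge_coloring_def by blast
qed

lemma permutation_of_color:
  shows "\<exists>p. p permutes {..<n} \<and> (\<forall>i\<in>rows a. col i (p i) = a)"
proof -
  have "\<forall>i\<in>rows a. \<exists>j. j < n \<and> col i j = a"
    by (auto simp: rows_def)
  then obtain g where g: "\<forall>i\<in>rows a. g i < n \<and> col i (g i) = a"
    by metis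
  have "inj_on g (rows a)"
  proof (rule inj_onI)
    fix i i' assume "i \<in> rows a" "i' \<in> rows a" "g i = g i'"
    then show "i = i'"
      using g same_row[of i i' "g i"] by (metis (no_types, lifting) mem_Collect_eq rows_def)
  qed
  then obtain p where "p permutes {..<n}" "\<forall>i\<in>rows a. p i = g i"
    using permutation_extending_injection[of "{..<n}" "rows a" g] g by (auto simp: rows_def)
  then show ?thesis
    using g by metis
qed

text \<open>The form in which acyclicity is used below: every orbit has to leave the two color classes,
  which is possible only at a left vertex that one of the colors misses.\<close>

lemma missing_vertices:
  assumes p: "p permutes {..<n}" "\<forall>i\<in>rows a. col i (p i) = a"
    and q: "q permutes {..<n}" "\<forall>i\<in>rows b. col i (q i) = b"
    and ab: "a \<noteq> b" and x: "x < n"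
  shows "\<exists>k. ((inv q \<circ> p) ^^ k) x \<in> {..<n} - (rows a \<inter> rows b)"
proof -
  obtain k where k: "let z = ((inv q \<circ> p) ^^ k) x in col z (p z) \<noteq> a \<or> col z (q z) \<noteq> b"
    using orbit_leaves_two_colors[OF p(1) q(1) ab x] by blast
  define z where "z = ((inv q \<circ> p) ^^ k) x"
  have "z \<notin> rows a \<inter> rows b"
    using k p(2) q(2) unfolding Let_def z_def[symmetric] by blast
  moreover have "z \<in> {..<n}"
    unfolding z_def using x
    by (subst permutes_in_image[OF permutes_funpow[OF permutes_compose[OF p(1) permutes_inv[OF q(1)]]]])
      simp
  ultimately show ?thesis
    unfolding z_def by blast
qed

section \<open>Sizes of the color classes\<close>

text \<open>Double counting: each of the \<open>n\<close> left vertices sees \<open>n\<close> distinct colors.\<close>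

lemma sum_card_rows:
  assumes "finite C" and C: "c ` edges (complete_bipartite n n) \<subseteq> C"
  shows "(\<Sum>a\<in>C. card (rows a)) = n * n"
proof -
  have "card {a \<in> C. i \<in> rows a} = n" if i: "i < n" for i
  proof -
    have "{a \<in> C. i \<in> rows a} = col i ` {..<n}"
      using i C edge by (auto simp: rows_def)
    moreover have "inj_on (col i) {..<n}"
      using i same_column by (auto intro!: inj_onI)
    ultimately show ?thesis
      by (simp add: card_image)
  qed
  then have "(\<Sum>a\<in>C. card {i \<in> {..<n}. i \<in> rows a}) = n * card {..<n}"
    using assms(1) by (intro sum_multicount) auto
  moreover have "{i \<in> {..<n}. i \<in> rows a} = rows a" for a
    by (auto simp: rows_def)
  ultimately show ?thesis
    by simp
qed

lemma card_rows_le: "card (rows a) \<le> n"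
  using card_mono[of "{..<n}" "rows a"] by (auto simp: rows_def)

lemma rows_full: "card (rows a) = n \<Longrightarrow> rows a = {..<n}"
  by (intro card_subset_eq) (auto simp: rows_def)

lemma perfect_color_unique:
  assumes "n > 0" "rows a = {..<n}" "rows b = {..<n}"
  shows "a = b"
proof (rule ccontr)
  assume ab: "a \<noteq> b"
  obtain p q where p: "p permutes {..<n}" "\<forall>i\<in>rows a. col i (p i) = a"
    and q: "q permutes {..<n}" "\<forall>i\<in>rows b. col i (q i) = b"
    using permutation_of_color by metis
  show False
    using missing_vertices[OF p q ab assms(1)] unfolding assms(2,3) by blast
qed

text \<open>The bound \<open>n + 1\<close> on the number of colors is exactly tight for counting: without a perfect class,
  at most \<open>(n + 1) * (n - 1) < n * n\<close> edges would be colored, and with one perfect class the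
  other classes must all attain their maximal size \<open>n - 1\<close>.\<close>

lemma color_classes:
  assumes "finite C" and C: "c ` edges (complete_bipartite n n) \<subseteq> C"
    and card: "card C \<le> n + 1" and n: "n > 1"
  obtains a where "a \<in> C" "rows a = {..<n}" "\<And>b. b \<in> C \<Longrightarrow> b \<noteq> a \<Longrightarrow> card (rows b) = n - 1"
proof -
  have small: "card (rows b) \<le> n - 1" if "rows b \<noteq> {..<n}" for b
    using that rows_full[of b] card_rows_le[of b] by linarith
  have n2: "(n + 1) * (n - 1) < n * n" "n * n = n + n * (n - 1)"
    using n by (cases n; simp)+
  have "\<exists>a\<in>C. rows a = {..<n}"
  proof (rule ccontr)
    assume "\<not> ?thesis"
    then have "(\<Sum>b\<in>C. card (rows b)) \<le> (\<Sum>b\<in>C. n - 1)"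
      by (intro sum_mono small) auto
    also have "\<dots> \<le> (n + 1) * (n - 1)"
      unfolding sum_constant of_nat_id by (rule mult_right_mono[OF card]) simp
    finally show False
      using sum_card_rows[OF assms(1) C] n2(1) by simp
  qed
  then obtain a where a: "a \<in> C" "rows a = {..<n}"
    by blast
  have le: "card (rows b) \<le> n - 1" if "b \<in> C - {a}" for b
    using that perfect_color_unique[of a b] a n small by auto
  have "(\<Sum>b\<in>C. card (rows b)) = n + (\<Sum>b\<in>C - {a}. card (rows b))"
    using sum.remove[OF assms(1) a(1), of "\<lambda>b. card (rows b)"] a(2) by simp
  then have sum: "(\<Sum>b\<in>C - {a}. card (rows b)) = n * (n - 1)"
    using sum_card_rows[OF assms(1) C] n2(2) by linarith
  have "card (rows b) = n - 1" if b: "b \<in> C" "b \<noteq> a" for b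
  proof (rule ccontr)
    assume "card (rows b) \<noteq> n - 1"
    then have "(\<Sum>b\<in>C - {a}. card (rows b)) < (\<Sum>b\<in>C - {a}. n - 1)"
      using le b assms(1) by (intro sum_strict_mono_ex1) (auto intro!: bexI[of _ b] simp: nat_less_le)
    also have "\<dots> = (card C - 1) * (n - 1)"
      using card_Diff_singleton[OF a(1)] by simp
    also have "\<dots> \<le> n * (n - 1)"
      using card by (intro mult_right_mono) auto
    finally show False
      using sum by simp
  qed
  then show thesis
    using that a by blast
qed

lemma missing_row:
  assumes "card (rows b) = n - 1" "n > 0"
  obtains u where "u < n" "rows b = {..<n} - {u}"
proof -
  have sub: "rows b \<subseteq> {..<n}"
    by (auto simp: rows_def)
  have "card ({..<n} - rows b) = 1"
    using assms sub by (simp add: card_Diff_subset finite_subset[OF sub])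
  then obtain u where "{..<n} - rows b = {u}"
    using card_1_singletonE by blast
  then show thesis
    using that[of u] sub by blast
qed

section \<open>Parity of the quotient permutations\<close>

text \<open>Since \<open>u\<close> is the only missed vertex, every orbit passes through it: the quotient is a single
  cycle of length \<open>n\<close>. In particular it has no fixed point when \<open>n \<noteq> 1\<close>, which shows that the edge
  from \<open>u\<close> to the right vertex missed by \<open>b\<close> does not have the color \<open>a\<close>.\<close>

lemma perfect_against_near_perfect:
  assumes p: "p permutes {..<n}" "\<forall>i\<in>rows a. col i (p i) = a"
    and q: "q permutes {..<n}" "\<forall>i\<in>rows b. col i (q i) = b"
    and ab: "a \<noteq> b" and a: "rows a = {..<n}" and b: "rows b = {..<n} - {u}" and u: "u < n"
  shows "evenperm (inv q \<circ> p) \<longleftrightarrow> odd n" and "n \<noteq> 1 \<Longrightarrow> p u \<noteq> q u"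
proof -
  have reach: "\<exists>k. ((inv q \<circ> p) ^^ k) x = u" if "x \<in> {..<n}" for x
    using missing_vertices[OF p q ab, of x] that a b by auto
  show "evenperm (inv q \<circ> p) \<longleftrightarrow> odd n"
    using evenperm_single_orbit[OF permutes_compose[OF p(1) permutes_inv[OF q(1)]] _ _ reach] u
    by simp
  show "p u \<noteq> q u" if n: "n \<noteq> 1"
  proof
    assume "p u = q u"
    then have fix_u: "(inv q \<circ> p) u = u"
      using permutes_inverses(2)[OF q(1)] by simp
    have inj: "inj ((inv q \<circ> p) ^^ k)" for k
      using permutes_inj[OF permutes_funpow[OF permutes_compose[OF p(1) permutes_inv[OF q(1)]]]] .
    have fix_k: "((inv q \<circ> p) ^^ k) u = u" for k
      using fix_u by (induction k) auto
    define x :: nat where "x = (if u = 0 then 1 else 0)"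
    have x: "x < n" "x \<noteq> u"
      using n u by (auto simp: x_def)
    then obtain k where "((inv q \<circ> p) ^^ k) x = u"
      using reach by auto
    then show False
      using fix_k[of k] inj[of k] x(2) by (metis injD)
  qed
qed

text \<open>The hypotheses on \<open>u\<close> say that the edge with which \<open>p\<close> completes the class \<open>a\<close> has color
  \<open>b\<close>. This edge is a component of its own, so \<open>u\<close> is a fixed point and does not lie on any other
  orbit; all other orbits must therefore pass through \<open>v\<close>, which leaves a single cycle of length
  \<open>n - 1\<close>.\<close>

lemma near_perfect_against_near_perfect:
  assumes p: "p permutes {..<n}" "\<forall>i\<in>rows a. col i (p i) = a"
    and q: "q permutes {..<n}" "\<forall>i\<in>rows b. col i (q i) = b"
    and ab: "a \<noteq> b" and a: "rows a = {..<n} - {u}" and b: "rows b = {..<n} - {v}"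
    and u: "u < n" "u \<in> rows b" "p u = q u" and v: "v < n"
  shows "evenperm (inv q \<circ> p) \<longleftrightarrow> even n"
proof -
  let ?r = "inv q \<circ> p"
  have r: "?r permutes {..<n}"
    by (rule permutes_compose[OF p(1) permutes_inv[OF q(1)]])
  have fix_u: "?r u = u"
    using u permutes_inverses(2)[OF q(1)] by simp
  have fix_k: "(?r ^^ k) u = u" for k
    using fix_u by (induction k) auto
  have r': "?r permutes ({..<n} - {u})"
    by (rule permutes_superset[OF r]) (use fix_u in auto)
  have reach: "\<exists>k. (?r ^^ k) x = v" if x: "x \<in> {..<n} - {u}" for x
  proof -
    obtain k where k: "(?r ^^ k) x \<in> {..<n} - (rows a \<inter> rows b)"
      using missing_vertices[OF p q ab, of x] x by auto
    have "(?r ^^ k) x \<noteq> u"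
      using permutes_in_image[OF permutes_funpow[OF r'], of k x] x by auto
    then show ?thesis
      using k a b by auto
  qed
  have "v \<in> {..<n} - {u}"
    using u(2) b v by auto
  then have "evenperm ?r \<longleftrightarrow> odd (card ({..<n} - {u}))"
    by (intro evenperm_single_orbit[OF r' _ _ reach]) auto
  also have "\<dots> \<longleftrightarrow> even n"
    using u(1) by simp
  finally show ?thesis .
qed

theorem card_colors_ge:
  assumes "finite C" and C: "c ` edges (complete_bipartite n n) \<subseteq> C"
    and n: "odd n" "n \<noteq> 1"
  shows "card C \<ge> n + 2"
proof (rule ccontr)
  assume "\<not> ?thesis"
  then have card: "card C \<le> n + 1"
    by simp
  have n1: "n > 1"
    using n by (metis One_nat_def Suc_lessI odd_pos)
  obtain a where a: "a \<in> C" "rows a = {..<n}"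
    and others: "\<And>b. b \<in> C \<Longrightarrow> b \<noteq> a \<Longrightarrow> card (rows b) = n - 1"
    using color_classes[OF assms(1) C card n1] by blast
  have in_C: "col i j \<in> C" if "i < n" "j < n" for i j
    using C edge[OF that] by blast
  obtain b where b: "b \<in> C" "b \<noteq> a"
    using in_C[of 0 0] in_C[of 0 1] same_column[of 0 0 1] n1 by (metis less_trans zero_less_one zero_neq_one)
  obtain u where u: "u < n" "rows b = {..<n} - {u}"
    using missing_row[OF others[OF b]] n1 by auto
  obtain p where p: "p permutes {..<n}" "\<forall>i\<in>rows a. col i (p i) = a"
    using permutation_of_color by blast
  obtain q where q: "q permutes {..<n}" "\<forall>i\<in>rows b. col i (q i) = b"
    using permutation_of_color by blast
  have qu: "q u < n"
    using permutes_in_image[OF q(1), of u] u(1) by simp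
  \<comment> \<open>\<open>q u\<close> is the right vertex missed by \<open>b\<close>, since \<open>q\<close> maps all other left vertices along \<open>b\<close>\<close>
  define d where "d = col u (q u)"
  have u_d: "u \<in> rows d"
    using u(1) qu by (auto simp: rows_def d_def)
  then have "d \<noteq> b"
    using u(2) by auto
  have "p u \<noteq> q u"
    using perfect_against_near_perfect(2)[OF p q b(2)[symmetric] a(2) u(2,1) n(2)] .
  moreover have "col u (p u) = a" "p u < n"
    using p u(1) a(2) permutes_in_image[OF p(1), of u] by auto
  ultimately have "d \<noteq> a"
    using same_column[OF u(1) _ qu] by (auto simp: d_def)
  have "d \<in> C"
    using in_C[OF u(1) qu] by (simp add: d_def)
  obtain v where v: "v < n" "rows d = {..<n} - {v}"
    using missing_row[OF others[OF \<open>d \<in> C\<close> \<open>d \<noteq> a\<close>]] n1 by auto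
  obtain s where s: "s permutes {..<n}" "\<forall>i\<in>rows d. col i (s i) = d"
    using permutation_of_color by blast
  have "s u = q u"
    using same_column[OF u(1) _ qu] s u_d permutes_in_image[OF s(1), of u] u(1)
    by (auto simp: d_def)
  \<comment> \<open>two even quotients and an odd one, although \<open>inv s \<circ> p\<close> equals \<open>(inv s \<circ> q) \<circ> (inv q \<circ> p)\<close>\<close>
  have "evenperm (inv q \<circ> p)" "evenperm (inv s \<circ> p)"
    using perfect_against_near_perfect(1)[OF p q b(2)[symmetric] a(2) u(2,1)]
      perfect_against_near_perfect(1)[OF p s \<open>d \<noteq> a\<close>[symmetric] a(2) v(2,1)] n(1) by auto
  moreover have "\<not> evenperm (inv s \<circ> q)"
    using near_perfect_against_near_perfect[OF q s \<open>d \<noteq> b\<close>[symmetric] u(2) v(2) u(1) u_d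
        \<open>s u = q u\<close>[symmetric] v(1)] n(1) by simp
  moreover have "permutation p" "permutation q" "permutation s"
    using p(1) q(1) s(1) permutation_permutes by blast+
  ultimately show False
    by (auto simp: evenperm_comp evenperm_inv permutation_inverse)
qed

end

section \<open>The acyclic chromatic index\<close>

lemma max_degree_complete_bipartite:
  assumes "n > 0"
  shows "max_degree (complete_bipartite n n) = n"
proof -
  have deg: "degree (complete_bipartite n n) v = n" if v: "v \<in> {..<n} <+> {..<n}" for v
  proof -
    consider i where "i < n" "v = Inl i" | j where "j < n" "v = Inr j"
      using v by auto
    then show ?thesis
    proof cases
      case (1 i)
      then have "{e \<in> edges (complete_bipartite n n). v \<in> e} = (\<lambda>j. {Inl i, Inr j}) ` {..<n}"
        by (auto simp: complete_bipartite_def)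
      moreover have "inj_on (\<lambda>j. {Inl i, Inr j} :: (nat + nat) set) {..<n}"
        by (auto intro!: inj_onI simp: doubleton_eq_iff)
      ultimately show ?thesis
        by (simp add: degree_def card_image)
    next
      case (2 j)
      then have "{e \<in> edges (complete_bipartite n n). v \<in> e} = (\<lambda>i. {Inl i, Inr j}) ` {..<n}"
        by (auto simp: complete_bipartite_def)
      moreover have "inj_on (\<lambda>i. {Inl i, Inr j} :: (nat + nat) set) {..<n}"
        by (auto intro!: inj_onI simp: doubleton_eq_iff)
      ultimately show ?thesis
        by (simp add: degree_def card_image)
    qed
  qed
  have "degree (complete_bipartite n n) ` ({..<n} <+> {..<n}) = {n}"
    using deg assms by (force intro!: image_eqI[of _ _ "Inl 0"])
  then show ?thesis
    by (simp add: max_degree_def complete_bipartite_def)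
qed

theorem theorem3:
  fixes n :: nat
  assumes "odd n" and "n \<noteq> 1"
  shows "acyclic_chromatic_index (complete_bipartite n n) \<ge> n + 2 \<and>
         n + 2 = max_degree (complete_bipartite n n) + 2"
proof -
  obtain C :: "nat set" and c where C: "finite C" "c ` edges (complete_bipartite n n) \<subseteq> C"
    "card C = acyclic_chromatic_index (complete_bipartite n n)"
    and "acyclic_edge_coloring (complete_bipartite n n) c"
    using acyclic_chromatic_index_attained[OF simple_graph_complete_bipartite[of n n]] by blast
  then interpret acyclic_bipartite_coloring n c
    by unfold_locales
  show ?thesis
    using card_colors_ge[OF C(1,2) assms] C(3) max_degree_complete_bipartite[of n] odd_pos[OF assms(1)]
    by simp
qed

end
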